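(* Let $G$ be a simple graph and $A\in\mathcal{S}(G)$. Suppose $m_1\geq \cdots \geq m_\ell$ are the eigenvalue multiplicities of $A$. Then, for any $r=1,\ldots,\ell$, \[\sum_{i=1}^r m_i \leq Z^{(r)}(G),\] where $Z^{(r)}(G) = \max\{ Z(H) : H \text{ an edge configuration of } \Gamma(G,r)\}$.
   Context: For a simple graph $G$, $\mathcal{S}(G)$ is the set of real symmetric matrices whose $ij$-entry ($i\neq j$) is nonzero exactly when $i\sim j$, with arbitrary diagonal. A lazy walk is a walk that may remain at a vertex at each step. $\Gamma(G,r)$ is the multigraph on $V(G)$ in which the number of edges between $i$ and $j$ is the number of lazy walks from $i$ to $j$ of length at most $r$. An edge configuration of a multigraph is a simple graph obtained by keeping, for each pair of vertices joined by multiple edges, either one or no edge (singleton edges are kept). $Z(H)$ is the (classical) zero forcing number of the simple graph $H$. Thus $Z^{(r)}(G)$ is the maximum zero forcing number over all edge configurations of $\Gamma(G,r)$; note $Z^{(1)}(G)=Z(G)$. *)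

theory Defs
  imports "HOL-Analysis.Analysis"
begin

text \<open>
  A graph is given by its adjacency relation; the vertex set is the whole (finite) type.
\<close>

definition simple_graph :: "('v \<Rightarrow> 'v \<Rightarrow> bool) \<Rightarrow> bool" where
  "simple_graph G \<longleftrightarrow> symp G \<and> irreflp G"

definition graph_matrices :: "('v::finite \<Rightarrow> 'v \<Rightarrow> bool) \<Rightarrow> (real^'v^'v) set" where
  "graph_matrices G =
     {A. transpose A = A \<and> (\<forall>i j. i \<noteq> j \<longrightarrow> (A $ i $ j \<noteq> 0 \<longleftrightarrow> G i j))}"


subsection \<open>Eigenvalues\<close>

definition eigenspace :: "real^'v^'v \<Rightarrow> real \<Rightarrow> (real^'v::finite) set" where
  "eigenspace A c = {x. A *v x = c *\<^sub>R x}"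

definition eigenvalues :: "real^'v^'v::finite \<Rightarrow> real set" where
  "eigenvalues A = {c. \<exists>x. x \<noteq> 0 \<and> A *v x = c *\<^sub>R x}"

text \<open>
  The matrices concerned are real symmetric, so geometric and algebraic multiplicities agree.
\<close>

definition eigenvalue_mult :: "real^'v^'v::finite \<Rightarrow> real \<Rightarrow> nat" where
  "eigenvalue_mult A c = dim (eigenspace A c)"


subsection \<open>Lazy walks and edge configurations\<close>

text \<open>
  A walk is the list of its successive vertices, so its length is one less than that of the list.
\<close>

definition lazy_walk :: "('v \<Rightarrow> 'v \<Rightarrow> bool) \<Rightarrow> 'v \<Rightarrow> 'v list \<Rightarrow> 'v \<Rightarrow> bool" where
  "lazy_walk G i p j \<longleftrightarrow>
     p \<noteq> [] \<and> hd p = i \<and> last p = j \<and> successively (\<lambda>u v. u = v \<or> G u v) p"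

definition walk_length :: "'v list \<Rightarrow> nat" where
  "walk_length p = length p - 1"

text \<open>
  A multigraph is given by its edge multiplicities; values on the diagonal (loops) are
  irrelevant to edge configurations, which are simple graphs.
\<close>

definition lazy_walk_multigraph :: "('v \<Rightarrow> 'v \<Rightarrow> bool) \<Rightarrow> nat \<Rightarrow> 'v \<Rightarrow> 'v \<Rightarrow> nat" where
  "lazy_walk_multigraph G r i j = card {p. lazy_walk G i p j \<and> walk_length p \<le> r}"

definition edge_configuration :: "('v \<Rightarrow> 'v \<Rightarrow> nat) \<Rightarrow> ('v \<Rightarrow> 'v \<Rightarrow> bool) \<Rightarrow> bool" where
  "edge_configuration M H \<longleftrightarrow> simple_graph H \<and>
     (\<forall>i j. i \<noteq> j \<longrightarrow> (M i j = 0 \<longrightarrow> \<not> H i j) \<and> (M i j = 1 \<longrightarrow> H i j))"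


subsection \<open>Zero forcing\<close>

text \<open>
  Sets of vertices are the sets of blue vertices; a blue vertex with exactly one white
  neighbour turns that neighbour blue.
\<close>

definition colour_change :: "('v \<Rightarrow> 'v \<Rightarrow> bool) \<Rightarrow> 'v set \<Rightarrow> 'v set \<Rightarrow> bool" where
  "colour_change H B B' \<longleftrightarrow>
     (\<exists>u\<in>B. \<exists>w. {v. H u v \<and> v \<notin> B} = {w} \<and> B' = insert w B)"

definition zero_forcing_set :: "('v \<Rightarrow> 'v \<Rightarrow> bool) \<Rightarrow> 'v set \<Rightarrow> bool" where
  "zero_forcing_set H S \<longleftrightarrow> (colour_change H)\<^sup>*\<^sup>* S UNIV"

definition zero_forcing_number :: "('v::finite \<Rightarrow> 'v \<Rightarrow> bool) \<Rightarrow> nat" where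
  "zero_forcing_number H = Min {card S |S. zero_forcing_set H S}"

definition zero_forcing_number_r :: "nat \<Rightarrow> ('v::finite \<Rightarrow> 'v \<Rightarrow> bool) \<Rightarrow> nat" where
  "zero_forcing_number_r r G =
     Max {zero_forcing_number H |H. edge_configuration (lazy_walk_multigraph G r) H}"


subsection \<open>The cardinality, minimum and maximum above are well defined\<close>

lemma finite_lazy_walks:
  fixes G :: "'v::finite \<Rightarrow> 'v \<Rightarrow> bool"
  shows "finite {p. lazy_walk G i p j \<and> walk_length p \<le> r}"
proof (rule finite_subset)
  show "{p. lazy_walk G i p j \<and> walk_length p \<le> r} \<subseteq> {p. set p \<subseteq> UNIV \<and> length p \<le> r + 1}"
    by (auto simp: walk_length_def)
  show "finite {p::'v list. set p \<subseteq> UNIV \<and> length p \<le> r + 1}"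
    by (rule finite_lists_length_le) simp
qed

lemma finite_zero_forcing_cards:
  fixes H :: "'v::finite \<Rightarrow> 'v \<Rightarrow> bool"
  shows "finite {card S |S. zero_forcing_set H S}"
  by simp

lemma zero_forcing_cards_nonempty: "{card S |S. zero_forcing_set H S} \<noteq> {}"
  by (auto simp: zero_forcing_set_def)

lemma finite_edge_configuration_numbers:
  fixes G :: "'v::finite \<Rightarrow> 'v \<Rightarrow> bool"
  shows "finite {zero_forcing_number H |H. edge_configuration (lazy_walk_multigraph G r) H}"
  by simp

lemma lazy_walk_rev:
  assumes "symp G" and "lazy_walk G i p j"
  shows "lazy_walk G j (rev p) i"
proof -
  have "successively (\<lambda>u v. v = u \<or> G v u) p"
    using assms by (auto simp: lazy_walk_def symp_def elim: successively_mono)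
  then show ?thesis
    using assms(2) by (simp add: lazy_walk_def hd_rev last_rev)
qed

lemma lazy_walk_multigraph_sym:
  assumes "symp G"
  shows "lazy_walk_multigraph G r i j = lazy_walk_multigraph G r j i"
proof -
  have "bij_betw rev {p. lazy_walk G i p j \<and> walk_length p \<le> r}
                     {p. lazy_walk G j p i \<and> walk_length p \<le> r}"
    by (rule bij_betw_byWitness[where f' = rev])
       (auto simp: walk_length_def intro: lazy_walk_rev[OF assms])
  then show ?thesis
    unfolding lazy_walk_multigraph_def by (rule bij_betw_same_card)
qed

lemma edge_configuration_exists:
  assumes "simple_graph G"
  shows "{zero_forcing_number H |H. edge_configuration (lazy_walk_multigraph G r) H} \<noteq> {}"
proof -
  have "symp G"
    using assms by (simp add: simple_graph_def)
  then have "edge_configuration (lazy_walk_multigraph G r)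
               (\<lambda>i j. i \<noteq> j \<and> lazy_walk_multigraph G r i j \<noteq> 0)"
    using lazy_walk_multigraph_sym[of G r]
    by (auto simp: edge_configuration_def simple_graph_def symp_def irreflp_def)
  then show ?thesis
    by blast
qed

end

(*
  For a product B of r factors A - c I, the off-diagonal entry B i j is a sum over lazy walks of
  length exactly r from i to j. A lazy walk that is the only one of length at most r has length r
  and no lazy steps (prefix, respectively delete, a repetition to see this), so its contribution is
  a product of nonzero off-diagonal entries of A. Hence the off-diagonal zero pattern of B is an
  edge configuration H. Taking the c to be the first r eigenvalues, the kernel of B contains the
  direct sum of their eigenspaces, and the nullity of a matrix with pattern H is at most Z(H).
*)
theory Submission
  imports Defs
begin

section \<open>Products of shifts of a matrix\<close>

text \<open>Each new factor is put on the left, so that expanding an entry of the product splits off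
  the first step of a walk. The shifts are indexed from 1, like the eigenvalues.\<close>

primrec shift_prod :: "real^'v^'v \<Rightarrow> (nat \<Rightarrow> real) \<Rightarrow> nat \<Rightarrow> real^'v^'v::finite" where
  "shift_prod A c 0 = mat 1"
| "shift_prod A c (Suc n) = (A - mat (c (Suc n))) ** shift_prod A c n"

lemma mat_mult_vec: "mat c *v x = c *\<^sub>R (x :: real^'v::finite)"
  by (simp add: mat_def matrix_vector_mult_def vec_eq_iff if_distrib[of "\<lambda>x. x * y" for y] cong: if_cong)

lemma mat_mult_commute: "mat c ** (B :: real^'v^'v::finite) = B ** mat c"
  by (simp add: mat_def matrix_matrix_mult_def vec_eq_iff if_distrib[of "\<lambda>x. x * y" for y]
      if_distrib[of "\<lambda>x. y * x" for y] mult.commute cong: if_cong)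

lemma matrix_diff_ldistrib: "A ** (B - C) = A ** B - A ** (C :: real^'n^'m)"
  by (simp add: matrix_matrix_mult_def vec_eq_iff right_diff_distrib sum_subtractf)

lemma matrix_diff_rdistrib: "(A - B) ** C = A ** C - B ** (C :: real^'n^'m)"
  by (simp add: matrix_matrix_mult_def vec_eq_iff left_diff_distrib sum_subtractf)

lemma shift_prod_commute: "shift_prod A c n ** A = A ** shift_prod A c n"
proof (induction n)
  case (Suc n)
  let ?D = "A - mat (c (Suc n))"
  have "?D ** A = A ** ?D"
    by (simp add: matrix_diff_ldistrib matrix_diff_rdistrib mat_mult_commute[of _ A])
  then have "A ** (?D ** shift_prod A c n) = ?D ** (A ** shift_prod A c n)"
    by (simp add: matrix_mul_assoc)
  with Suc show ?case
    by (simp flip: matrix_mul_assoc)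
qed simp

text \<open>Transposition reverses the order of the factors. They are polynomials in
  \<open>A\<close> and commute, so the reversed product is the same matrix.\<close>

lemma transpose_shift_prod:
  assumes "transpose A = A"
  shows "transpose (shift_prod A c n) = shift_prod A c n"
proof (induction n)
  case (Suc n)
  have "transpose (A - mat d) = A - mat d" for d
    using assms by (auto simp: vec_eq_iff transpose_def mat_def)
  with Suc have "transpose (shift_prod A c (Suc n)) = shift_prod A c n ** (A - mat (c (Suc n)))"
    by (simp add: matrix_transpose_mul)
  then show ?case
    by (simp add: matrix_diff_ldistrib matrix_diff_rdistrib shift_prod_commute
        mat_mult_commute[of _ "shift_prod A c n"])
qed simp

lemma shift_prod_mult_eigenvector:
  assumes "A *v x = d *\<^sub>R x"
  shows "shift_prod A c n *v x = (\<Prod>k=1..n. d - c k) *\<^sub>R x"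
proof (induction n)
  case (Suc n)
  have "shift_prod A c (Suc n) *v x = (A - mat (c (Suc n))) *v ((\<Prod>k=1..n. d - c k) *\<^sub>R x)"
    by (simp add: Suc flip: matrix_vector_mul_assoc)
  also have "\<dots> = (\<Prod>k=1..n. d - c k) *\<^sub>R (d - c (Suc n)) *\<^sub>R x"
    by (simp add: matrix_vector_mult_diff_rdistrib matrix_vector_mult_scaleR mat_mult_vec assms
        scaleR_left_diff_distrib)
  finally show ?case
    by simp
qed simp

lemma subspace_kernel: "subspace {x. B *v x = (0 :: real^'n::finite)}"
  by (simp add: subspace_def matrix_vector_right_distrib matrix_vector_mult_scaleR)

lemma subspace_eigenspace: "subspace (eigenspace A c)"
  by (simp add: subspace_def eigenspace_def matrix_vector_right_distrib matrix_vector_mult_scaleR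
      scaleR_add_right scaleR_left_commute)

text \<open>On the eigenspace for \<open>c (Suc n)\<close> the product of the first \<open>n\<close>
  factors acts as a nonzero scalar, because the shifts are distinct. Hence its kernel meets this
  eigenspace only in 0, their dimensions add, and both lie in the next kernel.\<close>

lemma sum_eigenvalue_mult_le_nullity:
  assumes "inj_on c {1..n}"
  shows "(\<Sum>i=1..n. eigenvalue_mult A (c i)) \<le> dim {x. shift_prod A c n *v x = 0}"
  using assms
proof (induction n)
  case (Suc n)
  let ?K = "\<lambda>n. {x. shift_prod A c n *v x = 0}" and ?E = "eigenspace A (c (Suc n))"
  have "inj_on c {1..n}"
    using Suc.prems by (rule inj_on_subset) auto
  note IH = Suc.IH[OF this]
  have ne: "(\<Prod>k=1..n. c (Suc n) - c k) \<noteq> 0"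
  proof -
    have "c (Suc n) \<noteq> c k" if "k \<in> {1..n}" for k
      using inj_onD[OF Suc.prems, of "Suc n" k] that by auto
    then show ?thesis
      by simp
  qed
  have "?K n \<inter> ?E \<subseteq> {0}"
  proof
    fix x assume "x \<in> ?K n \<inter> ?E"
    with ne show "x \<in> {0}"
      using shift_prod_mult_eigenvector[of A x "c (Suc n)" c n] by (simp add: eigenspace_def)
  qed
  then have "dim (?K n \<inter> ?E) = 0"
    by simp
  moreover have "{x + y |x y. x \<in> ?K n \<and> y \<in> ?E} \<subseteq> ?K (Suc n)"
  proof -
    have "shift_prod A c (Suc n) *v y = 0" if "y \<in> ?E" for y
      using that shift_prod_mult_eigenvector[of A y "c (Suc n)" c "Suc n"]
      by (simp add: eigenspace_def)
    moreover have "shift_prod A c (Suc n) *v x = 0" if "x \<in> ?K n" for x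
      using that by (simp flip: matrix_vector_mul_assoc)
    ultimately show ?thesis
      by (auto simp: matrix_vector_right_distrib simp del: shift_prod.simps)
  qed
  then have "dim {x + y |x y. x \<in> ?K n \<and> y \<in> ?E} \<le> dim (?K (Suc n))"
    by (rule dim_subset)
  ultimately show ?case
    using IH dim_sums_Int[OF subspace_kernel[of "shift_prod A c n"] subspace_eigenspace[of A "c (Suc n)"]]
    by (simp add: eigenvalue_mult_def del: dim_eq_0 shift_prod.simps)
qed simp

section \<open>Entries of the products and lazy walks\<close>

lemma lazy_walk_Cons:
  assumes "lazy_walk G k q j" and "i = k \<or> G i k"
  shows "lazy_walk G i (i # q) j"
  using assms by (cases q) (auto simp: lazy_walk_def)

text \<open>A nonzero entry has a nonzero summand. Its left factor gives a first step from
  \<open>i\<close> to \<open>k\<close>, lazy if it is a diagonal entry, and its right factor gives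
  the rest by induction.\<close>

lemma shift_prod_nonzero_imp_lazy_walk:
  assumes "A \<in> graph_matrices G" and "shift_prod A c n $ i $ j \<noteq> 0"
  shows "\<exists>p. lazy_walk G i p j \<and> walk_length p \<le> n"
  using assms(2)
proof (induction n arbitrary: i)
  case 0
  then have "i = j"
    by (auto simp: mat_def split: if_splits)
  then have "lazy_walk G i [i] j \<and> walk_length [i] \<le> 0"
    by (simp add: lazy_walk_def walk_length_def)
  then show ?case ..
next
  case (Suc n)
  then obtain k where k: "(A - mat (c (Suc n))) $ i $ k * shift_prod A c n $ k $ j \<noteq> 0"
    by (auto simp: matrix_matrix_mult_def elim: sum.not_neutral_contains_not_neutral)
  with Suc.IH obtain q where q: "lazy_walk G k q j" "walk_length q \<le> n"
    by fastforce
  have "i = k \<or> G i k"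
    using k assms(1) by (auto simp: graph_matrices_def mat_def split: if_splits)
  with q have "lazy_walk G i (i # q) j"
    by (auto intro: lazy_walk_Cons)
  moreover have "walk_length (i # q) \<le> Suc n"
    using q(2) by (auto simp: walk_length_def)
  ultimately show ?case
    by blast
qed

text \<open>When the entry is expanded by the first step, only the summand belonging to the unique
  walk survives, so nothing can cancel it. That first step is not lazy, so no shifted diagonal
  entry, which might vanish, occurs as its factor.\<close>

lemma shift_prod_nonzero_if_unique_lazy_walk:
  assumes "A \<in> graph_matrices G"
    and "\<exists>!p. lazy_walk G i p j \<and> walk_length p \<le> n"
  shows "shift_prod A c n $ i $ j \<noteq> 0"
  using assms(2)
proof (induction n arbitrary: i)
  case 0
  then obtain p where "lazy_walk G i p j" "length p \<le> 1"
    by (auto simp: walk_length_def)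
  then have "i = j"
    by (cases p) (auto simp: lazy_walk_def)
  then show ?case
    by (simp add: mat_def)
next
  case (Suc n)
  let ?W = "\<lambda>n i p. lazy_walk G i p j \<and> walk_length p \<le> n"
  obtain p where p: "?W (Suc n) i p" and uniq: "\<And>p'. ?W (Suc n) i p' \<Longrightarrow> p' = p"
    using Suc.prems by blast
  have extend: "i # q = p" if "?W n k q" "i = k \<or> G i k" for k q
    using that by (intro uniq) (auto intro: lazy_walk_Cons simp: walk_length_def)
  obtain q where q: "p = i # q"
    using p by (cases p) (auto simp: lazy_walk_def)
  have "q \<noteq> []"
  \<comment> \<open>Otherwise \<open>p\<close> is \<open>[i]\<close>, and prefixing a lazy step
    gives the second walk \<open>[i, i]\<close>, still within the length bound
    \<open>Suc n\<close>.\<close>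
  proof
    assume "q = []"
    with p q have "?W n i [i]"
      by (simp add: lazy_walk_def walk_length_def)
    from extend[OF this] q \<open>q = []\<close> show False
      by simp
  qed
  define k where "k = hd q"
  have qW: "?W n k q" and adj: "i = k \<or> G i k"
    using p q \<open>q \<noteq> []\<close> by (auto simp: lazy_walk_def walk_length_def k_def successively_Cons)
  have "i \<noteq> k"
  \<comment> \<open>A lazy first step could be deleted, and the tail \<open>q\<close> would be a
    shorter walk from \<open>i\<close> to \<open>j\<close>.\<close>
  proof
    assume "i = k"
    then have "q = p"
      using qW by (intro uniq) auto
    with q show False
      by simp
  qed
  \<comment> \<open>Uniqueness passes to the tail, since two different tails would extend to two
    different walks from \<open>i\<close>.\<close>
  have "\<exists>!q. ?W n k q"
    using qW extend[OF _ adj] q by blast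
  then have "shift_prod A c n $ k $ j \<noteq> 0"
    by (rule Suc.IH)
  moreover have "(A - mat (c (Suc n))) $ i $ k \<noteq> 0"
    using assms(1) adj \<open>i \<noteq> k\<close> by (simp add: graph_matrices_def mat_def)
  moreover have "(A - mat (c (Suc n))) $ i $ k' * shift_prod A c n $ k' $ j = 0"
    if "k' \<in> UNIV - {k}" for k'
  \<comment> \<open>A nonzero summand at \<open>k'\<close> would yield a walk from \<open>i\<close>
    through \<open>k'\<close>. By uniqueness its tail is \<open>q\<close>, which starts at
    \<open>k\<close>.\<close>
  proof (rule ccontr)
    assume nz: "\<not> ?thesis"
    then obtain q' where q': "?W n k' q'"
      using shift_prod_nonzero_imp_lazy_walk[OF assms(1), of c n k' j] by auto
    have "i = k' \<or> G i k'"
      using nz assms(1) by (auto simp: graph_matrices_def mat_def split: if_splits)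
    with extend[OF q'] q have "q' = q"
      by simp
    with q' that show False
      by (simp add: lazy_walk_def k_def)
  qed
  then have "shift_prod A c (Suc n) $ i $ j = (A - mat (c (Suc n))) $ i $ k * shift_prod A c n $ k $ j"
    by (simp add: matrix_matrix_mult_def sum.remove[of UNIV k] sum.neutral del: mult_eq_0_iff)
  ultimately show ?case
    by simp
qed

text \<open>For symmetric \<open>B\<close> this is the graph whose set \<open>graph_matrices\<close>
  contains \<open>B\<close>.\<close>

definition matrix_graph :: "real^'v^'v \<Rightarrow> 'v \<Rightarrow> 'v \<Rightarrow> bool" where
  "matrix_graph B i j \<longleftrightarrow> i \<noteq> j \<and> B $ i $ j \<noteq> 0"

text \<open>Multiplicities 0 and 1 are settled by the two lemmas on entries. For larger
  multiplicities terms may cancel or not, and a configuration allows both outcomes.\<close>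

lemma edge_configuration_shift_prod:
  assumes "A \<in> graph_matrices G"
  shows "edge_configuration (lazy_walk_multigraph G n) (matrix_graph (shift_prod A c n))"
proof -
  have "transpose (shift_prod A c n) = shift_prod A c n"
    using assms by (intro transpose_shift_prod) (simp add: graph_matrices_def)
  then have "transpose (shift_prod A c n) $ i $ j = shift_prod A c n $ i $ j" for i j
    by simp
  then have sym: "shift_prod A c n $ j $ i = shift_prod A c n $ i $ j" for i j
    by (simp only: transpose_def vec_lambda_beta)
  have zero: "shift_prod A c n $ i $ j = 0" if "lazy_walk_multigraph G n i j = 0" for i j
  proof -
    \<comment> \<open>Finiteness matters here: \<open>card\<close> is also 0 on infinite
      sets.\<close>
    have "{p. lazy_walk G i p j \<and> walk_length p \<le> n} = {}"
      using that by (simp only: lazy_walk_multigraph_def card_0_eq[OF finite_lazy_walks])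
    then show ?thesis
      using shift_prod_nonzero_imp_lazy_walk[OF assms] by blast
  qed
  have one: "shift_prod A c n $ i $ j \<noteq> 0" if unique: "lazy_walk_multigraph G n i j = 1" for i j
  proof (rule shift_prod_nonzero_if_unique_lazy_walk[OF assms])
    obtain p where "{p. lazy_walk G i p j \<and> walk_length p \<le> n} = {p}"
      using unique unfolding lazy_walk_multigraph_def by (rule card_1_singletonE)
    then show "\<exists>!p. lazy_walk G i p j \<and> walk_length p \<le> n"
      by (intro ex1I[of _ p]) blast+
  qed
  have "simple_graph (matrix_graph (shift_prod A c n))"
    unfolding simple_graph_def
  proof
    show "symp (matrix_graph (shift_prod A c n))"
    proof (rule sympI)
      fix i j assume "matrix_graph (shift_prod A c n) i j"
      then show "matrix_graph (shift_prod A c n) j i"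
        using sym[of i j] by (auto simp: matrix_graph_def)
    qed
    show "irreflp (matrix_graph (shift_prod A c n))"
      by (rule irreflpI) (simp add: matrix_graph_def)
  qed
  then show ?thesis
    using zero one by (simp only: edge_configuration_def matrix_graph_def) simp
qed

section \<open>Zero forcing bounds the nullity\<close>

lemma kernel_vanishes_if_zero_forcing:
  assumes "(colour_change (matrix_graph B))\<^sup>*\<^sup>* S T"
    and "B *v x = 0" and "\<forall>i\<in>S. x $ i = 0"
  shows "\<forall>i\<in>T. x $ i = 0"
  using assms(1)
proof induction
  case base
  show ?case by fact
next
  case (step T T')
  from step.hyps(2) obtain u w where u: "u \<in> T" and w: "{v. matrix_graph B u v \<and> v \<notin> T} = {w}"
    and T': "T' = insert w T"
    unfolding colour_change_def by blast
  \<comment> \<open>In row \<open>u\<close> the blue vertices, among them \<open>u\<close> itself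
    with its arbitrary diagonal entry, contribute 0 because \<open>x\<close> vanishes there. White
    vertices other than \<open>w\<close> are not neighbours of \<open>u\<close>.\<close>
  have "B $ u $ v * x $ v = 0" if "v \<in> UNIV - {w}" for v
    using that w u step.IH by (cases "v \<in> T") (auto simp: matrix_graph_def)
  then have "(B *v x) $ u = B $ u $ w * x $ w"
    by (simp add: matrix_vector_mult_def sum.remove[of UNIV w] sum.neutral del: mult_eq_0_iff)
  moreover have "B $ u $ w \<noteq> 0"
    using w by (auto simp: matrix_graph_def)
  ultimately have "x $ w = 0"
    using assms(2) by simp
  with T' step.IH show ?case
    by simp
qed

text \<open>A kernel vector vanishing on \<open>S\<close> is 0, so restriction of coordinates to
  \<open>S\<close> is injective on the kernel, and its image lies in the span of
  \<open>card S\<close> unit vectors.\<close>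

lemma nullity_le_card_zero_forcing_set:
  fixes B :: "real^'v^'v::finite"
  assumes "zero_forcing_set (matrix_graph B) S"
  shows "dim {x. B *v x = 0} \<le> card S"
proof -
  let ?K = "{x. B *v x = 0}" and ?f = "\<lambda>x :: real^'v. \<chi> i. if i \<in> S then x $ i else 0"
  have lin: "linear ?f"
    by (auto intro!: linearI simp: vec_eq_iff)
  have "x = 0" if "x \<in> ?K" "?f x = 0" for x
  proof -
    have "\<forall>i\<in>S. x $ i = 0"
      using that(2) by (auto simp: vec_eq_iff split: if_splits)
    then have "\<forall>i\<in>UNIV. x $ i = 0"
      using kernel_vanishes_if_zero_forcing[of B S UNIV x] assms that(1)
      by (simp add: zero_forcing_set_def)
    then show ?thesis
      by (simp add: vec_eq_iff)
  qed
  then have "inj_on ?f ?K"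
    using linear_injective_on_subspace_0[OF lin subspace_kernel] by blast
  then have "dim ?K = dim (?f ` ?K)"
    using dim_image_eq[OF lin, of ?K, symmetric] subspace_kernel[of B]
    by (simp add: span_eq_iff[THEN iffD2])
  also have "?f x \<in> span ((\<lambda>i. axis i 1) ` S)" for x
  proof -
    have "?f x = (\<Sum>i\<in>S. x $ i *\<^sub>R axis i 1)"
      by (simp add: vec_eq_iff axis_def if_distrib[of "\<lambda>x. y * x" for y] cong: if_cong)
    also have "\<dots> \<in> span ((\<lambda>i. axis i 1) ` S)"
      by (intro span_sum span_scale span_base) auto
    finally show ?thesis .
  qed
  then have "dim (?f ` ?K) \<le> card ((\<lambda>i. axis i (1::real)) ` S)"
    by (intro dim_le_card image_subsetI finite_imageI) simp_all
  also have "\<dots> \<le> card S"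
    by (rule card_image_le) simp
  finally show ?thesis .
qed

lemma nullity_le_zero_forcing_number:
  "dim {x. B *v x = 0} \<le> zero_forcing_number (matrix_graph B)"
  unfolding zero_forcing_number_def
  by (rule Min.boundedI[OF finite_zero_forcing_cards zero_forcing_cards_nonempty])
     (auto intro: nullity_le_card_zero_forcing_set)

theorem mainTheorem2:
  fixes G :: "'v::finite \<Rightarrow> 'v \<Rightarrow> bool"
    and A :: "real^'v^'v"
    and l r :: nat
    and ev :: "nat \<Rightarrow> real"
    and m :: "nat \<Rightarrow> nat"
  assumes "simple_graph G"
    and "A \<in> graph_matrices G"
    and "bij_betw ev {1..l} (eigenvalues A)"
    and "\<forall>i\<in>{1..l}. m i = eigenvalue_mult A (ev i)"
    and "\<forall>i\<in>{1..l}. \<forall>j\<in>{1..l}. i \<le> j \<longrightarrow> m j \<le> m i"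
    and "r \<in> {1..l}"
  shows "(\<Sum>i=1..r. m i) \<le> zero_forcing_number_r r G"
proof -
  let ?B = "shift_prod A ev r"
  have "inj_on ev {1..r}"
    using assms(3,6) by (auto simp: bij_betw_def intro: inj_on_subset)
  have "(\<Sum>i=1..r. m i) = (\<Sum>i=1..r. eigenvalue_mult A (ev i))"
    using assms(4,6) by (intro sum.cong) auto
  also have "\<dots> \<le> dim {x. ?B *v x = 0}"
    by (rule sum_eigenvalue_mult_le_nullity) fact
  also have "\<dots> \<le> zero_forcing_number (matrix_graph ?B)"
    by (rule nullity_le_zero_forcing_number)
  \<comment> \<open>The graph of the product is one of the configurations over which the maximum is
    taken.\<close>
  also have "\<dots> \<le> zero_forcing_number_r r G"
    unfolding zero_forcing_number_r_def
    using edge_configuration_shift_prod[OF assms(2)] by (intro Max_ge) auto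
  finally show ?thesis .
qed

end
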